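(* Let $b\ge 2$ be an integer, and let $\phi:\mathbb{R}\to\mathbb{R}^d$ be a non-constant $\mathbb{Z}$-periodic $C^3$ function. Then $p'(\phi,b)<d$, and there exist only finitely many $\lambda\in(1/b,1)$ with $p'(\phi,b)<q'(\phi,\lambda,b)$.
   Context: Let $\Lambda=\{0,1,\dots,b-1\}$, $\Sigma=\Lambda^{\mathbb{Z}_+}$. For $\lambda\in(1/b,1)$ put $\gamma=\frac{1}{b\lambda}\in(1/b,1)$, and for a $\mathbb{Z}$-periodic $C^1$ function $\psi:\mathbb{R}\to\mathbb{R}^d$ and $\mathbf{j}=j_1j_2\cdots\in\Sigma$ put $$Y^{\psi}_{\lambda,b}(x,\mathbf{j})=-\sum_{n=1}^{\infty}\gamma^n\,\psi'\!\left(\frac{x}{b^n}+\frac{j_1}{b^n}+\frac{j_2}{b^{n-1}}+\cdots+\frac{j_n}{b}\right),\quad x\in\mathbb{R}.$$ Given $\lambda$, $\psi$ satisfies condition (H$^*$) if $Y^{\psi}_{\lambda,b}(x,\mathbf{j})-Y^{\psi}_{\lambda,b}(x,\mathbf{i})=0$ for all $x\in\mathbb{R}$ and all $\mathbf{i},\mathbf{j}\in\Sigma$. For a linear subspace $V\subset\mathbb{R}^d$ (with $V=\{0\}$ allowed), $\pi_V$ is the orthogonal projection onto $V$. Define $$q'(\phi,\lambda,b)=\max\{\dim V: V\subset\mathbb{R}^d\text{ a linear subspace such that }\pi_V\phi\text{ satisfies (H}^* )\text{ for }\lambda\},$$ $$p'(\phi,b)=\min_{\lambda\in(1/b,1)}q'(\phi,\lambda,b).$$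 *)

theory Defs
  imports "HOL-Analysis.Analysis"
begin

definition Z_periodic :: "(real \<Rightarrow> 'a) \<Rightarrow> bool" where
  "Z_periodic f \<longleftrightarrow> (\<forall>x. \<forall>k::int. f (x + of_int k) = f x)"

text \<open>Here \<open>D i\<close> is the \<open>i\<close>-th derivative of \<open>f\<close>.\<close>

definition Ck_function :: "nat \<Rightarrow> (real \<Rightarrow> 'a::real_normed_vector) \<Rightarrow> bool" where
  "Ck_function k f \<longleftrightarrow>
     (\<exists>D. D 0 = f \<and>
          (\<forall>i<k. \<forall>x. (D i has_vector_derivative D (Suc i) x) (at x)) \<and>
          continuous_on UNIV (D k))"

definition orth_proj :: "'a::euclidean_space set \<Rightarrow> 'a \<Rightarrow> 'a" where
  "orth_proj V x = (THE p. p \<in> V \<and> x - p \<in> V\<^sup>\<bottom>)"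

text \<open>Words are indexed from \<open>1\<close>; a member of the extensional function space is determined
  by its digits \<open>j 1\<close>, \<open>j 2\<close>, \dots\<close>

definition digit_seqs :: "nat \<Rightarrow> (nat \<Rightarrow> nat) set" where
  "digit_seqs b = {1..} \<rightarrow>\<^sub>E {..<b}"

text \<open>The series over \<open>n \<ge> 1\<close> is written as a series over \<open>n \<ge> 0\<close> of the summands at \<open>Suc n\<close>.
  It converges absolutely for the functions \<open>\<psi>\<close> of interest: \<open>0 < 1 / (b * lam) < 1\<close> for
  \<open>1 / b < lam < 1\<close>, and the derivative of a periodic \<open>C\<^sup>1\<close> function is bounded.\<close>

definition Y_summand ::
  "(real \<Rightarrow> 'a::real_normed_vector) \<Rightarrow> real \<Rightarrow> nat \<Rightarrow> real \<Rightarrow> (nat \<Rightarrow> nat) \<Rightarrow> nat \<Rightarrow> 'a" where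
  "Y_summand \<psi> lam b x j n =
     (1 / (real b * lam)) ^ n *\<^sub>R
       vector_derivative \<psi> (at (x / real b ^ n + (\<Sum>k=1..n. real (j k) / real b ^ (n + 1 - k))))"

definition Y_fun ::
  "(real \<Rightarrow> 'a::real_normed_vector) \<Rightarrow> real \<Rightarrow> nat \<Rightarrow> real \<Rightarrow> (nat \<Rightarrow> nat) \<Rightarrow> 'a" where
  "Y_fun \<psi> lam b x j = - (\<Sum>n. Y_summand \<psi> lam b x j (Suc n))"

definition H_star :: "(real \<Rightarrow> 'a::real_normed_vector) \<Rightarrow> real \<Rightarrow> nat \<Rightarrow> bool" where
  "H_star \<psi> lam b \<longleftrightarrow>
     (\<forall>x. \<forall>i \<in> digit_seqs b. \<forall>j \<in> digit_seqs b. Y_fun \<psi> lam b x j - Y_fun \<psi> lam b x i = 0)"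

definition q_prime :: "(real \<Rightarrow> 'a::euclidean_space) \<Rightarrow> real \<Rightarrow> nat \<Rightarrow> nat" where
  "q_prime \<phi> lam b = Max {dim V | V. subspace V \<and> H_star (\<lambda>x. orth_proj V (\<phi> x)) lam b}"

definition p_prime :: "(real \<Rightarrow> 'a::euclidean_space) \<Rightarrow> nat \<Rightarrow> nat" where
  "p_prime \<phi> b = Min ((\<lambda>lam. q_prime \<phi> lam b) ` {1 / real b <..< 1})"

lemma orth_proj_works:
  assumes "subspace V"
  shows "orth_proj V x \<in> V \<and> x - orth_proj V x \<in> V\<^sup>\<bottom>"
  unfolding orth_proj_def
proof (rule theI')
  have span: "span V = V"
    using assms by (simp add: span_eq_iff)
  obtain y z where y: "y \<in> V" and z: "\<And>w. w \<in> V \<Longrightarrow> orthogonal z w" and x: "x = y + z"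
    using orthogonal_subspace_decomp_exists[of V x] unfolding span by blast
  show "\<exists>!p. p \<in> V \<and> x - p \<in> V\<^sup>\<bottom>"
  proof (rule ex1I[of _ y])
    show *: "y \<in> V \<and> x - y \<in> V\<^sup>\<bottom>"
      using y z x by (auto simp: orthogonal_comp_def orthogonal_commute)
    fix p assume p: "p \<in> V \<and> x - p \<in> V\<^sup>\<bottom>"
    have "y - p \<in> V"
      using y p assms by (blast intro: subspace_diff)
    then have "orthogonal (y - p) (x - p)" "orthogonal (y - p) (x - y)"
      using p * unfolding orthogonal_comp_def by blast+
    then have "(y - p) \<bullet> (y - p) = 0"
      by (simp add: orthogonal_def inner_diff_right inner_diff_left inner_commute)
    then show "p = y" by simp
  qed
qed

text \<open>The maximum and the minimum above range over finite nonempty sets.\<close>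

lemma q_prime_set:
  fixes \<phi> :: "real \<Rightarrow> 'a::euclidean_space" and lam :: real and b :: nat
  defines "S \<equiv> {dim V | V. subspace V \<and> H_star (\<lambda>x. orth_proj V (\<phi> x)) lam b}"
  shows "finite S" "S \<noteq> {}"
proof -
  show "finite S"
    by (rule finite_subset[of _ "{..DIM('a)}"]) (use dim_subset_UNIV in \<open>auto simp only: S_def atMost_iff\<close>)
  have "orth_proj {0} (\<phi> x) = 0" for x
    using orth_proj_works[of "{0}" "\<phi> x"] by simp
  then have "H_star (\<lambda>x. orth_proj {0} (\<phi> x)) lam b"
    by (simp add: H_star_def Y_fun_def Y_summand_def)
  then have "dim {0::'a} \<in> S"
    unfolding S_def using subspace_single_0 by blast
  then show "S \<noteq> {}" by blast
qed

lemma p_prime_set: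
  fixes \<phi> :: "real \<Rightarrow> 'a::euclidean_space" and b :: nat
  defines "S \<equiv> (\<lambda>lam. q_prime \<phi> lam b) ` {1 / real b <..< 1}"
  shows "finite S" "b \<ge> 2 \<Longrightarrow> S \<noteq> {}"
proof -
  have "q_prime \<phi> lam b \<le> DIM('a)" for lam
  proof -
    have "q_prime \<phi> lam b \<in> {dim V | V. subspace V \<and> H_star (\<lambda>x. orth_proj V (\<phi> x)) lam b}"
      unfolding q_prime_def by (rule Max_in[OF q_prime_set])
    then obtain V :: "'a set" where "q_prime \<phi> lam b = dim V" by blast
    then show ?thesis using dim_subset_UNIV[of V] by argo
  qed
  then have "S \<subseteq> {..DIM('a)}"
    unfolding S_def by blast
  then show "finite S"
    by (rule finite_subset) (rule finite_atMost)
  show "S \<noteq> {}" if "b \<ge> 2"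
  proof -
    have "1 / real b < 1"
      using that by simp
    then obtain lam where "lam \<in> {1 / real b <..< 1}"
      using dense by (metis greaterThanLessThan_iff)
    then show ?thesis
      unfolding S_def by blast
  qed
qed

end

theory Submission
  imports Defs "HOL-Complex_Analysis.Complex_Analysis"
begin

text \<open>Put \<open>\<gamma> = 1 / (b \<lambda>)\<close>. Since \<open>Y\<close> is linear in \<open>\<phi>\<close>, \<open>q'\<close> is the dimension of the orthogonal
  complement of the vectors \<open>Y(x, i) - Y(x, j)\<close>, and by continuity it suffices to take words
  \<open>i\<close>, \<open>j\<close> that differ in finitely many digits. For such words the \<open>n\<close>-th evaluation points are
  \<open>O(b\<^sup>-\<^sup>n)\<close> apart and \<open>\<phi>'\<close> is Lipschitz, so the difference is a power series in \<open>\<gamma>\<close> that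
  converges for \<open>\<bar>\<gamma>\<bar> < b\<close>, past the endpoint \<open>\<gamma> = 1\<close>. The rank of a family of analytic vectors
  attains its maximum off a finite subset of the compact interval \<open>[0, 1]\<close>, which gives finiteness.
  If all these series vanished, their coefficients would show that \<open>\<phi>'\<close> has every period
  \<open>b\<^sup>-\<^sup>n\<close>; then \<open>\<phi>'\<close> is constant, and so is the periodic function \<open>\<phi>\<close>.\<close>

subsection \<open>Orthogonal projections and analytic families of vectors\<close>

lemma orth_proj_eqI:
  assumes "subspace V" "p \<in> V" "x - p \<in> V\<^sup>\<bottom>"
  shows "orth_proj V x = p"
proof -
  note q = orth_proj_works[OF assms(1), of x]
  have "p - orth_proj V x \<in> V"
    using q assms by (blast intro: subspace_diff)
  moreover have "p - orth_proj V x \<in> V\<^sup>\<bottom>"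
    using subspace_diff[OF subspace_orthogonal_comp, of "x - orth_proj V x" V "x - p"] q assms
    by simp
  ultimately have "orthogonal (p - orth_proj V x) (p - orth_proj V x)"
    unfolding orthogonal_comp_def by blast
  then show ?thesis
    by (simp add: orthogonal_self)
qed

lemma linear_orth_proj:
  assumes "subspace V"
  shows "linear (orth_proj V)"
proof (rule linearI)
  note q = orth_proj_works[OF assms]
  show "orth_proj V (x + y) = orth_proj V x + orth_proj V y" for x y
  proof (rule orth_proj_eqI[OF assms])
    show "orth_proj V x + orth_proj V y \<in> V"
      using q assms by (blast intro: subspace_add)
    show "x + y - (orth_proj V x + orth_proj V y) \<in> V\<^sup>\<bottom>"
      using subspace_add[OF subspace_orthogonal_comp, of "x - orth_proj V x" V "y - orth_proj V y"] q
      by (simp add: algebra_simps)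
  qed
  show "orth_proj V (c *\<^sub>R x) = c *\<^sub>R orth_proj V x" for c x
  proof (rule orth_proj_eqI[OF assms])
    show "c *\<^sub>R orth_proj V x \<in> V"
      using q assms by (blast intro: subspace_scale)
    show "c *\<^sub>R x - c *\<^sub>R orth_proj V x \<in> V\<^sup>\<bottom>"
      using subspace_scale[OF subspace_orthogonal_comp, of "x - orth_proj V x" V c] q
      by (simp add: algebra_simps)
  qed
qed

lemma orth_proj_ident: "subspace V \<Longrightarrow> x \<in> V \<Longrightarrow> orth_proj V x = x"
  by (rule orth_proj_eqI) (auto simp: subspace_0[OF subspace_orthogonal_comp])

lemma inner_orth_proj:
  assumes "subspace V"
  shows "x \<bullet> orth_proj V x = orth_proj V x \<bullet> orth_proj V x"
proof -
  have "orthogonal (orth_proj V x) (x - orth_proj V x)"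
    using orth_proj_works[OF assms, of x] by (auto simp: orthogonal_comp_def)
  then show ?thesis
    by (simp add: orthogonal_def inner_diff_right inner_commute)
qed

lemma orth_proj_eq_0_iff:
  assumes "subspace V"
  shows "orth_proj V x = 0 \<longleftrightarrow> x \<in> V\<^sup>\<bottom>"
proof
  assume "orth_proj V x = 0"
  then show "x \<in> V\<^sup>\<bottom>"
    using orth_proj_works[OF assms, of x] by simp
qed (auto intro!: orth_proj_eqI assms subspace_0)

text \<open>With \<open>W\<close> the complement at \<open>t0\<close> and \<open>J\<close> a finite set of indices whose vectors at \<open>t0\<close> cut
  out \<open>W\<close>, the operator \<open>v \<mapsto> \<Sum>k\<in>J. (F k t \<bullet> v) F k t0 + orth_proj W v\<close> is injective at \<open>t0\<close>, so
  its determinant, a holomorphic function of \<open>t\<close>, does not vanish identically; wherever it is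
  nonzero, the operator embeds the complement at \<open>t\<close> into \<open>W\<close>.\<close>

lemma finite_dim_orthogonal_comp_jumps:
  fixes F :: "'k \<Rightarrow> real \<Rightarrow> real ^ 'd" and T :: "real set"
  assumes S: "open S" "connected S" and T: "compact T" "of_real ` T \<subseteq> S" "t0 \<in> T"
    and ext: "\<And>k c. k \<in> I \<Longrightarrow>
      \<exists>g. g holomorphic_on S \<and> (\<forall>t\<in>T. g (of_real t) = complex_of_real (F k t $ c))"
  shows "finite {t \<in> T. dim (((\<lambda>k. F k t0) ` I)\<^sup>\<bottom>) < dim (((\<lambda>k. F k t) ` I)\<^sup>\<bottom>)}"
proof -
  define W where "W = ((\<lambda>k. F k t0) ` I)\<^sup>\<bottom>"
  have W: "subspace W"
    unfolding W_def by (rule subspace_orthogonal_comp)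
  obtain B where B: "B \<subseteq> (\<lambda>k. F k t0) ` I" "independent B" "(\<lambda>k. F k t0) ` I \<subseteq> span B"
    using basis_exists by metis
  have "finite B"
    using B(2) by (rule independent_imp_finite)
  then obtain J where J: "J \<subseteq> I" "finite J" "B = (\<lambda>k. F k t0) ` J"
    using B(1) by (meson finite_subset_image)
  obtain g where g: "\<And>k c. k \<in> I \<Longrightarrow> g k c holomorphic_on S"
    "\<And>k c t. k \<in> I \<Longrightarrow> t \<in> T \<Longrightarrow> g k c (of_real t) = complex_of_real (F k t $ c)"
    using ext by metis
  define L where "L t v = (\<Sum>k\<in>J. (F k t \<bullet> v) *\<^sub>R F k t0) + orth_proj W v" for t v
  have lin: "linear (L t)" for t
    unfolding L_def
    by (intro linear_compose_add linear_compose_sum linear_orth_proj W ballI)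
       (auto intro!: linearI simp: inner_add_right scaleR_left_distrib)
  have inj0: "inj (L t0)"
    unfolding linear_injective_0[OF lin]
  proof safe
    fix v assume "L t0 v = 0"
    \<comment> \<open>Pairing with \<open>v\<close> turns \<open>L t0 v\<close> into a sum of
      nonnegative terms, so each of them vanishes.\<close>
    then have "0 = v \<bullet> L t0 v" by simp
    also have "\<dots> = (\<Sum>k\<in>J. (F k t0 \<bullet> v)\<^sup>2) + orth_proj W v \<bullet> orth_proj W v"
      by (simp add: L_def inner_add_right inner_sum_right inner_orth_proj[OF W] inner_commute
          power2_eq_square)
    finally have *: "(\<Sum>k\<in>J. (F k t0 \<bullet> v)\<^sup>2) + orth_proj W v \<bullet> orth_proj W v = 0" by simp
    have nn: "(\<Sum>k\<in>J. (F k t0 \<bullet> v)\<^sup>2) \<ge> 0" by (intro sum_nonneg) auto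
    have Pv: "orth_proj W v = 0"
      using * nn inner_ge_zero[of "orth_proj W v"] by (smt (verit) inner_eq_zero_iff)
    have "(\<Sum>k\<in>J. (F k t0 \<bullet> v)\<^sup>2) = 0"
      using * nn inner_ge_zero[of "orth_proj W v"] by linarith
    then have "\<forall>k\<in>J. F k t0 \<bullet> v = 0"
      using J(2) by (subst (asm) sum_nonneg_eq_0_iff) auto
    then have "orthogonal v y" if "y \<in> B" for y
      using that J(3) by (auto simp: orthogonal_def inner_commute)
    then have "orthogonal y v" if "y \<in> span B" for y
      using orthogonal_to_span that orthogonal_commute by blast
    then have "v \<in> W"
      using B(3) unfolding W_def orthogonal_comp_def by blast
    then show "v = 0"
      using Pv orth_proj_ident[OF W] by simp
  qed
  \<comment> \<open>Only the factor \<open>F k t\<close> of \<open>L t\<close> is replaced by its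
    extension \<open>g\<close>; \<open>F k t0\<close> and the projection stay fixed. So
    \<open>G\<close> extends the determinant of \<open>L t\<close> from \<open>T\<close> to
    \<open>S\<close>.\<close>
  define G where "G z = det (\<chi> r c. (\<Sum>k\<in>J. g k c z * of_real (F k t0 $ r))
      + of_real (orth_proj W (axis c 1) $ r) :: complex ^ 'd ^ 'd)" for z
  have holG: "G holomorphic_on S"
    unfolding G_def det_def using J(1) g(1)
    by (auto intro!: holomorphic_intros)
  have Gt: "G (of_real t) = of_real (det (matrix (L t)))" if "t \<in> T" for t
  proof -
    have "(\<Sum>k\<in>J. g k c (of_real t) * of_real (F k t0 $ r)) + of_real (orth_proj W (axis c 1) $ r)
        = complex_of_real (matrix (L t) $ r $ c)" for r c
      using J(1) that by (auto simp: matrix_def L_def g(2) inner_axis intro!: sum.cong)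
    then show ?thesis
      unfolding G_def det_def by simp
  qed
  have det_inj: "det (matrix (L t)) \<noteq> 0 \<longleftrightarrow> inj (L t)" for t
    using lin[of t] by (metis det_nz_iff_inj matrix_works linear_matrix_vector_mul_eq)
  have "finite {z \<in> of_real ` T. G z = 0}"
  proof (cases "G constant_on S")
    \<comment> \<open>The theorem on finitely many zeros in a compact set asks for a nonconstant
      function. A constant \<open>G\<close> has no zeros, since it equals its nonzero value at
      \<open>t0\<close>.\<close>
    case True
    then obtain a where a: "\<And>z. z \<in> S \<Longrightarrow> G z = a"
      unfolding constant_on_def by blast
    have "G (of_real t0) \<noteq> 0"
      using inj0 det_inj Gt[OF T(3)] by simp
    moreover have "G (of_real t0) = a"
      using a T by blast
    ultimately have "G z \<noteq> 0" if "z \<in> of_real ` T" for z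
      using a that T(2) by auto
    then have "{z \<in> of_real ` T. G z = 0} = {}"
      by blast
    then show ?thesis by (metis finite.emptyI)
  next
    case False
    then show ?thesis
      using holG S T by (intro holomorphic_compact_finite_zeros[of G S])
        (auto intro!: compact_continuous_image continuous_intros)
  qed
  then have "finite (complex_of_real -` {z \<in> of_real ` T. G z = 0})"
    by (rule finite_vimageI) (simp add: inj_def)
  moreover have "{t \<in> T. dim W < dim (((\<lambda>k. F k t) ` I)\<^sup>\<bottom>)}
      \<subseteq> complex_of_real -` {z \<in> of_real ` T. G z = 0}"
  proof
    fix t assume "t \<in> {t \<in> T. dim W < dim (((\<lambda>k. F k t) ` I)\<^sup>\<bottom>)}"
    then have t: "t \<in> T" and less: "dim W < dim (((\<lambda>k. F k t) ` I)\<^sup>\<bottom>)"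
      by auto
    have "\<not> inj (L t)"
    proof
      assume "inj (L t)"
      then have "dim (L t ` (((\<lambda>k. F k t) ` I)\<^sup>\<bottom>)) = dim (((\<lambda>k. F k t) ` I)\<^sup>\<bottom>)"
        by (intro dim_image_eq lin) (auto intro: inj_on_subset)
      moreover have "L t v \<in> W" if "v \<in> ((\<lambda>k. F k t) ` I)\<^sup>\<bottom>" for v
      proof -
        have "F k t \<bullet> v = 0" if "k \<in> J" for k
          using that J(1) \<open>v \<in> _\<close> by (auto simp: orthogonal_comp_def orthogonal_def)
        then show ?thesis
          using orth_proj_works[OF W] by (simp add: L_def)
      qed
      ultimately show False
        using less dim_subset[of "L t ` (((\<lambda>k. F k t) ` I)\<^sup>\<bottom>)" W] by fastforce
    qed
    then have "det (matrix (L t)) = 0"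
      using det_inj by blast
    then show "t \<in> complex_of_real -` {z \<in> of_real ` T. G z = 0}"
      using Gt[OF t] t by simp
  qed
  ultimately show ?thesis
    unfolding W_def by (rule finite_subset[rotated])
qed


subsection \<open>Periodic functions\<close>

lemma Z_periodic_derivative:
  assumes "Z_periodic f" and f': "\<And>x. (f has_vector_derivative f' x) (at x)"
  shows "Z_periodic f'"
  unfolding Z_periodic_def
proof (intro allI)
  fix x and k :: int
  have "((f \<circ> (\<lambda>x. x + of_int k)) has_vector_derivative 1 *\<^sub>R f' (x + of_int k)) (at x)"
    by (rule vector_diff_chain_at) (auto intro!: derivative_eq_intros f')
  moreover have "f \<circ> (\<lambda>x. x + of_int k) = f"
    using assms(1) by (auto simp: Z_periodic_def)
  ultimately have "(f has_vector_derivative f' (x + of_int k)) (at x)"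
    by simp
  then show "f' (x + of_int k) = f' x"
    using f' by (rule vector_derivative_unique_at)
qed

lemma Z_periodic_bounded:
  fixes f :: "real \<Rightarrow> 'a::real_normed_vector"
  assumes "Z_periodic f" "continuous_on UNIV f"
  obtains M where "\<And>x. norm (f x) \<le> M"
proof -
  have "bounded (f ` {0..1})"
    by (intro compact_imp_bounded compact_continuous_image continuous_on_subset[OF assms(2)]) auto
  then obtain M where M: "\<And>x. x \<in> {0..1} \<Longrightarrow> norm (f x) \<le> M"
    unfolding bounded_iff by blast
  have "norm (f x) \<le> M" for x
  proof -
    have "f (frac x + of_int \<lfloor>x\<rfloor>) = f (frac x)"
      using assms(1) unfolding Z_periodic_def by blast
    then have "f x = f (frac x)" by (simp add: frac_def)
    then show ?thesis
      using M[of "frac x"] frac_lt_1[of x] by (simp add: less_imp_le)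
  qed
  then show ?thesis by (rule that)
qed

lemma has_vector_derivative_bounded_imp_lipschitz:
  fixes f :: "real \<Rightarrow> 'a::real_normed_vector"
  assumes "\<And>x. (f has_vector_derivative f' x) (at x)" "\<And>x. norm (f' x) \<le> M"
  shows "norm (f x - f y) \<le> M * \<bar>x - y\<bar>"
proof -
  have "norm (f x - f y) \<le> M * norm (x - y)"
  proof (rule differentiable_bound[of UNIV])
    show "(f has_derivative (\<lambda>h. h *\<^sub>R f' x)) (at x within UNIV)" for x
      using assms(1) by (simp add: has_vector_derivative_def)
    show "onorm (\<lambda>h. h *\<^sub>R f' x) \<le> M" for x
      using assms(2)[of x] by (intro onorm_bound) (auto simp: mult.commute[of M] mult_left_mono intro: order_trans[OF norm_ge_zero])
  qed auto
  then show ?thesis by simp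
qed

subsection \<open>Power series with vector coefficients\<close>

lemma summable_norm_le_geometric:
  fixes f :: "nat \<Rightarrow> 'a::banach"
  assumes "\<And>n. norm (f n) \<le> K * q ^ n" "\<bar>q\<bar> < 1"
  shows "summable f"
proof (rule summable_comparison_test')
  show "summable (\<lambda>n. K * q ^ n)"
    using assms(2) by (intro summable_mult summable_geometric) simp
qed (rule assms(1))

text \<open>Comparison with a geometric series. The radius is \<open>r = 1\<close> for merely
  bounded coefficients and \<open>r = b\<close> for the decaying ones.\<close>

lemma summable_powser_scaleR:
  fixes u :: "nat \<Rightarrow> 'a::banach"
  assumes "\<And>n. norm (u n) \<le> K / r ^ n" "\<bar>t\<bar> < r"
  shows "summable (\<lambda>n. t ^ n *\<^sub>R u n)"
proof (rule summable_norm_le_geometric)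
  show "norm (t ^ n *\<^sub>R u n) \<le> K * (\<bar>t\<bar> / r) ^ n" for n
    using mult_left_mono[OF assms(1)[of n], of "\<bar>t\<bar> ^ n"]
    by (simp add: power_abs power_divide mult.commute)
qed (use assms(2) in auto)

text \<open>The complex power series with the same coefficients converges on the whole disc. It
  supplies the hypothesis \<open>ext\<close> of \<open>finite_dim_orthogonal_comp_jumps\<close>, one
  coordinate at a time.\<close>

lemma powser_component_holomorphic_extension:
  fixes u :: "nat \<Rightarrow> real ^ 'd"
  assumes u: "\<And>n. norm (u n) \<le> K / r ^ n"
  obtains g where "g holomorphic_on ball 0 r"
    "\<And>t. \<bar>t\<bar> < r \<Longrightarrow> g (of_real t) = complex_of_real ((\<Sum>n. t ^ n *\<^sub>R u n) $ c)"
proof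
  define g where "g z = (\<Sum>n. complex_of_real (u n $ c) * z ^ n)" for z
  have summ: "summable (\<lambda>n. complex_of_real (u n $ c) * z ^ n)" if "norm z < r" for z
  proof (rule summable_norm_le_geometric)
    show "norm (complex_of_real (u n $ c) * z ^ n) \<le> K * (norm z / r) ^ n" for n
    proof -
      have "\<bar>u n $ c\<bar> \<le> K / r ^ n"
        using component_le_norm_cart[of "u n" c] u[of n] by linarith
      from mult_right_mono[OF this, of "norm z ^ n"] show ?thesis
        by (simp add: norm_mult norm_power power_divide)
    qed
    show "\<bar>norm z / r\<bar> < 1"
      using that norm_ge_zero[of z] by (auto simp del: norm_ge_zero)
  qed
  show "g holomorphic_on ball 0 r"
    by (rule power_series_holomorphic[of _ _ "\<lambda>n. complex_of_real (u n $ c)"])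
       (use summ in \<open>auto simp: g_def intro: summable_sums\<close>)
  show "g (of_real t) = complex_of_real ((\<Sum>n. t ^ n *\<^sub>R u n) $ c)" if "\<bar>t\<bar> < r" for t
  proof -
    note st = summable_powser_scaleR[OF u that]
    have "(\<Sum>n. t ^ n *\<^sub>R u n) $ c = (\<Sum>n. (t ^ n *\<^sub>R u n) $ c)"
      by (rule bounded_linear.suminf[OF bounded_linear_vec_nth st])
    moreover have "summable (\<lambda>n. (t ^ n *\<^sub>R u n) $ c)"
      by (rule bounded_linear.summable[OF bounded_linear_vec_nth st])
    ultimately show ?thesis
      by (simp add: g_def suminf_of_real mult.commute)
  qed
qed

text \<open>Zeros are isolated: a nonzero coefficient keeps some coordinate of the series nonzero on
  a punctured neighbourhood of 0. That coordinate vanishes at 0 itself because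
  \<open>u 0 = 0\<close>.\<close>

lemma powser_scaleR_eq_0_imp_coeff_eq_0:
  fixes u :: "nat \<Rightarrow> real ^ 'd"
  assumes u: "\<And>n. norm (u n) \<le> K" and zero: "\<And>t. 0 < t \<Longrightarrow> t < 1 \<Longrightarrow> (\<Sum>n. t ^ n *\<^sub>R u n) = 0"
    and "u 0 = 0"
  shows "u n = 0"
proof (rule ccontr)
  assume "u n \<noteq> 0"
  then obtain c where c: "u n $ c \<noteq> 0"
    by (auto simp: vec_eq_iff)
  define f where "f t = (\<Sum>n. u n $ c * t ^ n)" for t
  have st: "summable (\<lambda>n. t ^ n *\<^sub>R u n)" if "\<bar>t\<bar> < 1" for t
    by (rule summable_powser_scaleR[of u K 1]) (use u that in auto)
  have sums: "(\<lambda>n. u n $ c * (t - 0) ^ n) sums f t" if "norm (t - 0) < 1" for t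
    using bounded_linear.summable[OF bounded_linear_vec_nth st, of t c] that
    by (auto simp: f_def mult.commute intro: summable_sums)
  have "n > 0"
    using \<open>u n \<noteq> 0\<close> \<open>u 0 = 0\<close> by (cases n) auto
  obtain s where s: "0 < s" "\<And>t. t \<in> cball 0 s - {0} \<Longrightarrow> f t \<noteq> 0"
    by (rule powser_0_nonzero[OF zero_less_one sums _ c \<open>n > 0\<close>])
       (use \<open>u 0 = 0\<close> in \<open>auto simp: f_def\<close>)
  \<comment> \<open>Small enough for the punctured ball on which \<open>f\<close> has no zero, and
    below 1 so that \<open>zero\<close> applies.\<close>
  define t where "t = min s (1 / 2)"
  have t: "0 < t" "t < 1" "t \<in> cball 0 s - {0}"
    using s(1) by (auto simp: t_def)
  have "f t = (\<Sum>n. t ^ n *\<^sub>R u n) $ c"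
    using bounded_linear.suminf[OF bounded_linear_vec_nth st, of t c] t
    by (simp add: f_def mult.commute)
  then show False
    using zero t s(2) by simp
qed

subsection \<open>Differences of the functions \<open>Y\<close>\<close>

text \<open>The orbit of \<open>x\<close> under inverse branches of multiplication by
  \<open>b\<close> modulo 1, chosen by the word: \<open>y_0 = x\<close> and
  \<open>y_n = (y_(n-1) + j n) / b\<close>.\<close>

definition digit_point :: "nat \<Rightarrow> real \<Rightarrow> (nat \<Rightarrow> nat) \<Rightarrow> nat \<Rightarrow> real" where
  "digit_point b x j n = x / real b ^ n + (\<Sum>k=1..n. real (j k) / real b ^ (n + 1 - k))"

text \<open>Second word minus first, to absorb the minus sign in front of the series in
  \<open>Y_fun\<close>.\<close>

definition digit_diff ::
  "(real \<Rightarrow> 'a::real_normed_vector) \<Rightarrow> nat \<Rightarrow> real \<times> (nat \<Rightarrow> nat) \<times> (nat \<Rightarrow> nat) \<Rightarrow> nat \<Rightarrow> 'a" where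
  "digit_diff h b = (\<lambda>(x, i, j) n. h (digit_point b x j n) - h (digit_point b x i n))"

text \<open>The series of \<open>Y\<close> starts at \<open>n = 1\<close>, but starting at \<open>n = 0\<close> changes nothing here, since
  \<open>digit_point b x j 0 = x\<close> does not depend on the word.\<close>

definition diff_series ::
  "(real \<Rightarrow> 'a::real_normed_vector) \<Rightarrow> nat \<Rightarrow> real \<times> (nat \<Rightarrow> nat) \<times> (nat \<Rightarrow> nat) \<Rightarrow> real \<Rightarrow> 'a" where
  "diff_series h b p t = (\<Sum>n. t ^ n *\<^sub>R digit_diff h b p n)"

definition digit_pairs :: "nat \<Rightarrow> (real \<times> (nat \<Rightarrow> nat) \<times> (nat \<Rightarrow> nat)) set" where
  "digit_pairs b = UNIV \<times> digit_seqs b \<times> digit_seqs b"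

definition tail_pairs :: "nat \<Rightarrow> (real \<times> (nat \<Rightarrow> nat) \<times> (nat \<Rightarrow> nat)) set" where
  "tail_pairs b = {(x, i, j) \<in> digit_pairs b. \<exists>N. \<forall>k>N. i k = j k}"

lemma norm_digit_diff_le:
  assumes "\<And>x. norm (h x) \<le> M"
  shows "norm (digit_diff h b p n) \<le> 2 * M"
proof -
  have "norm (h x - h y) \<le> M + M" for x y
    using norm_triangle_ineq4[of "h x" "h y"] assms[of x] assms[of y] by linarith
  then show ?thesis
    by (simp add: digit_diff_def split_beta)
qed

lemma summable_diff_series:
  fixes h :: "real \<Rightarrow> 'a::banach"
  assumes "\<And>x. norm (h x) \<le> M" "\<bar>t\<bar> < 1"
  shows "summable (\<lambda>n. t ^ n *\<^sub>R digit_diff h b p n)"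
  by (rule summable_powser_scaleR[of _ "2 * M" 1]) (use norm_digit_diff_le[OF assms(1)] assms(2) in auto)

lemma Y_fun_diff:
  fixes \<phi> :: "real \<Rightarrow> 'a::banach"
  assumes \<phi>': "\<And>x. (\<phi> has_vector_derivative \<phi>' x) (at x)" and M: "\<And>x. norm (\<phi>' x) \<le> M"
    and \<gamma>: "\<bar>1 / (real b * lam)\<bar> < 1"
  shows "Y_fun \<phi> lam b x i - Y_fun \<phi> lam b x j = diff_series \<phi>' b (x, i, j) (1 / (real b * lam))"
proof -
  let ?\<gamma> = "1 / (real b * lam)"
  have Y: "Y_summand \<phi> lam b x j = (\<lambda>n. ?\<gamma> ^ n *\<^sub>R \<phi>' (digit_point b x j n))" for j
    unfolding Y_summand_def digit_point_def by (simp add: vector_derivative_at[OF \<phi>'])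
  have summ: "summable (Y_summand \<phi> lam b x j)" for j
    unfolding Y by (rule summable_powser_scaleR[of _ M 1]) (use M \<gamma> in auto)
  have "Y_fun \<phi> lam b x i - Y_fun \<phi> lam b x j
      = (\<Sum>n. Y_summand \<phi> lam b x j n) - (\<Sum>n. Y_summand \<phi> lam b x i n)"
    unfolding Y_fun_def suminf_split_head[OF summ] by (simp add: Y digit_point_def)
  also have "\<dots> = diff_series \<phi>' b (x, i, j) ?\<gamma>"
    unfolding suminf_diff[OF summ summ]
    by (simp add: Y diff_series_def digit_diff_def scaleR_diff_right)
  finally show ?thesis .
qed

lemma diff_series_bounded_linear:
  fixes h :: "real \<Rightarrow> 'a::banach"
  assumes "bounded_linear f" "\<And>x. norm (h x) \<le> M" "\<bar>t\<bar> < 1"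
  shows "diff_series (\<lambda>x. f (h x)) b p t = f (diff_series h b p t)"
proof -
  interpret bounded_linear f by fact
  show ?thesis
    unfolding diff_series_def suminf[OF summable_diff_series[OF assms(2,3)]]
    by (simp add: digit_diff_def split_beta diff scaleR)
qed

lemma H_star_orth_proj_iff:
  fixes \<phi> :: "real \<Rightarrow> 'a::euclidean_space"
  assumes \<phi>': "\<And>x. (\<phi> has_vector_derivative \<phi>' x) (at x)" and M: "\<And>x. norm (\<phi>' x) \<le> M"
    and \<gamma>: "\<bar>1 / (real b * lam)\<bar> < 1" and V: "subspace V"
  shows "H_star (\<lambda>x. orth_proj V (\<phi> x)) lam b \<longleftrightarrow>
    V \<subseteq> ((\<lambda>p. diff_series \<phi>' b p (1 / (real b * lam))) ` digit_pairs b)\<^sup>\<bottom>"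
proof -
  let ?\<gamma> = "1 / (real b * lam)"
  have bl: "bounded_linear (orth_proj V)"
    using linear_orth_proj[OF V] by (simp add: linear_conv_bounded_linear)
  have d: "((\<lambda>x. orth_proj V (\<phi> x)) has_vector_derivative orth_proj V (\<phi>' x)) (at x)" for x
    by (rule bounded_linear.has_vector_derivative[OF bl \<phi>'])
  obtain K where K: "\<And>x. norm (orth_proj V x) \<le> norm x * K" "K > 0"
    using bounded_linear.pos_bounded[OF bl] by blast
  have M': "norm (orth_proj V (\<phi>' x)) \<le> M * K" for x
    using K(1)[of "\<phi>' x"] K(2) mult_right_mono[OF M[of x], of K] by (auto intro: order_trans)
  have "H_star (\<lambda>x. orth_proj V (\<phi> x)) lam b \<longleftrightarrow>
      (\<forall>p\<in>digit_pairs b. orth_proj V (diff_series \<phi>' b p ?\<gamma>) = 0)"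
    unfolding H_star_def Y_fun_diff[OF d M' \<gamma>] diff_series_bounded_linear[OF bl M \<gamma>] digit_pairs_def
    by blast
  also have "\<dots> \<longleftrightarrow> V \<subseteq> ((\<lambda>p. diff_series \<phi>' b p ?\<gamma>) ` digit_pairs b)\<^sup>\<bottom>"
    unfolding orth_proj_eq_0_iff[OF V] orthogonal_comp_def using orthogonal_commute by blast
  finally show ?thesis .
qed

text \<open>For a pair of arbitrary words, replace the tail of one by the tail of the other and
  pass to the limit.\<close>

lemma orthogonal_comp_tail_pairs:
  fixes h :: "real \<Rightarrow> 'a::euclidean_space"
  assumes M: "\<And>x. norm (h x) \<le> M" and t: "\<bar>t\<bar> < 1"
  shows "((\<lambda>p. diff_series h b p t) ` tail_pairs b)\<^sup>\<bottom> = ((\<lambda>p. diff_series h b p t) ` digit_pairs b)\<^sup>\<bottom>"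
proof
  show "((\<lambda>p. diff_series h b p t) ` digit_pairs b)\<^sup>\<bottom> \<subseteq> ((\<lambda>p. diff_series h b p t) ` tail_pairs b)\<^sup>\<bottom>"
    by (intro orthogonal_comp_anti_mono image_mono) (auto simp: tail_pairs_def)
  show "((\<lambda>p. diff_series h b p t) ` tail_pairs b)\<^sup>\<bottom> \<subseteq> ((\<lambda>p. diff_series h b p t) ` digit_pairs b)\<^sup>\<bottom>"
  proof
    fix v assume v: "v \<in> ((\<lambda>p. diff_series h b p t) ` tail_pairs b)\<^sup>\<bottom>"
    have "diff_series h b (x, i, j) t \<bullet> v = 0" if ij: "i \<in> digit_seqs b" "j \<in> digit_seqs b" for x i j
    proof -
      define iN where "iN N k = (if k \<le> N then i k else j k)" for N k :: nat
      have "(x, iN N, j) \<in> tail_pairs b" for N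
        using ij by (auto simp: tail_pairs_def digit_pairs_def digit_seqs_def iN_def PiE_iff
            extensional_def intro!: exI[of _ N])
      then have zero: "diff_series h b (x, iN N, j) t \<bullet> v = 0" for N
        using v by (auto simp: orthogonal_comp_def orthogonal_def)
      have split: "diff_series h b (x, i, j) t = diff_series h b (x, i, iN N) t + diff_series h b (x, iN N, j) t" for N
        unfolding diff_series_def suminf_add[OF summable_diff_series[OF M t] summable_diff_series[OF M t]]
        by (simp add: digit_diff_def flip: scaleR_add_right)
      \<comment> \<open>The other summand is orthogonal to \<open>v\<close>, so this inner product
        does not depend on \<open>N\<close>; it remains to see that it tends to 0.\<close>
      have eq: "diff_series h b (x, i, iN N) t \<bullet> v = diff_series h b (x, i, j) t \<bullet> v" for N
        unfolding split[of N] inner_add_left zero by simp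
      define a where "a n N = (t ^ n *\<^sub>R digit_diff h b (x, i, iN N) n) \<bullet> v" for n N
      \<comment> \<open>Dominated convergence for series: the \<open>n\<close>-th term vanishes once
        \<open>N \<ge> n\<close>, and a geometric series bounds the terms uniformly in
        \<open>N\<close>.\<close>
      have "(\<lambda>N. \<Sum>n. a n N) \<longlonglongrightarrow> (\<Sum>n. 0 :: real)"
      proof (rule tannerys_theorem[THEN conjunct2, THEN conjunct2])
        show "(\<lambda>N. a n N) \<longlonglongrightarrow> 0" for n
        proof (rule tendsto_eventually)
          have "a n N = 0" if "N \<ge> n" for N
          proof -
            have "digit_point b x (iN N) n = digit_point b x i n"
              unfolding digit_point_def iN_def using that by (intro arg_cong2[of _ _ _ _ "(+)"] sum.cong) auto
            then show ?thesis by (simp add: a_def digit_diff_def)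
          qed
          then show "\<forall>\<^sub>F N in sequentially. a n N = 0"
            using eventually_sequentially by blast
        qed
        have "norm (a n N) \<le> 2 * M * norm v * \<bar>t\<bar> ^ n" for n N
        proof -
          have "norm (a n N) \<le> norm (t ^ n *\<^sub>R digit_diff h b (x, i, iN N) n) * norm v"
            unfolding a_def real_norm_def by (rule Cauchy_Schwarz_ineq2)
          also have "\<dots> = (\<bar>t\<bar> ^ n * norm v) * norm (digit_diff h b (x, i, iN N) n)"
            by (simp add: power_abs)
          also have "\<dots> \<le> (\<bar>t\<bar> ^ n * norm v) * (2 * M)"
            by (intro mult_left_mono norm_digit_diff_le M) auto
          finally show ?thesis by (simp add: mult_ac)
        qed
        then show "\<forall>\<^sub>F (n, N) in at_top \<times>\<^sub>F sequentially. norm (a n N) \<le> 2 * M * norm v * \<bar>t\<bar> ^ n"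
          by (intro always_eventually) auto
        show "summable (\<lambda>n. 2 * M * norm v * \<bar>t\<bar> ^ n)"
          using t by (intro summable_mult summable_geometric) auto
      qed auto
      moreover have "(\<Sum>n. a n N) = diff_series h b (x, i, iN N) t \<bullet> v" for N
        unfolding a_def diff_series_def
        by (rule bounded_linear.suminf[OF bounded_linear_inner_left summable_diff_series[OF M t], symmetric])
      ultimately have "(\<lambda>N. diff_series h b (x, i, j) t \<bullet> v) \<longlonglongrightarrow> 0"
        by (simp add: eq)
      then show ?thesis
        using LIMSEQ_unique tendsto_const by blast
    qed
    then show "v \<in> ((\<lambda>p. diff_series h b p t) ` digit_pairs b)\<^sup>\<bottom>"
      by (auto simp: orthogonal_comp_def orthogonal_def digit_pairs_def)
  qed
qed

text \<open>The admissible \<open>V\<close> are exactly the subspaces of this complement, which is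
  itself admissible and so has the largest dimension.\<close>

lemma q_prime_eq:
  fixes \<phi> :: "real \<Rightarrow> 'a::euclidean_space"
  assumes \<phi>': "\<And>x. (\<phi> has_vector_derivative \<phi>' x) (at x)" and M: "\<And>x. norm (\<phi>' x) \<le> M"
    and \<gamma>: "\<bar>1 / (real b * lam)\<bar> < 1"
  shows "q_prime \<phi> lam b = dim (((\<lambda>p. diff_series \<phi>' b p (1 / (real b * lam))) ` tail_pairs b)\<^sup>\<bottom>)"
proof -
  define W where "W = ((\<lambda>p. diff_series \<phi>' b p (1 / (real b * lam))) ` tail_pairs b)\<^sup>\<bottom>"
  have H: "H_star (\<lambda>x. orth_proj V (\<phi> x)) lam b \<longleftrightarrow> V \<subseteq> W" if "subspace V" for V
    using H_star_orth_proj_iff[OF \<phi>' M \<gamma> that] orthogonal_comp_tail_pairs[of \<phi>', OF M \<gamma>]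
    unfolding W_def by simp
  have "subspace W"
    unfolding W_def by (rule subspace_orthogonal_comp)
  then show ?thesis
    unfolding q_prime_def W_def[symmetric]
    by (intro Max_eqI q_prime_set) (use H in \<open>auto intro: dim_subset\<close>)
qed

section \<open>Decay of the coefficients and finiteness of the dimension jumps\<close>

lemma digit_diff_decay:
  assumes lip: "\<And>x y. norm (h x - h y) \<le> L * \<bar>x - y\<bar>" and b: "b > 0"
    and p: "p \<in> tail_pairs b"
  obtains K where "\<And>n. norm (digit_diff h b p n) \<le> K / real b ^ n"
proof -
  obtain x i j N where pe: "p = (x, i, j)" and N: "\<And>k. k > N \<Longrightarrow> i k = j k"
    using p by (auto simp: tail_pairs_def)
  \<comment> \<open>For \<open>k \<le> n\<close>, digit \<open>k\<close> moves the
    \<open>n\<close>-th point by at most \<open>f k / b ^ n\<close>. The numerator is independent of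
    \<open>n\<close> and vanishes for \<open>k > N\<close>.\<close>
  define f where "f k = \<bar>real (j k) - real (i k)\<bar> * real b ^ (k - 1)" for k
  have L: "L \<ge> 0"
    using lip[of 1 0] order_trans[OF norm_ge_zero] by fastforce
  have "norm (digit_diff h b p n) \<le> L * (\<Sum>k=1..N. f k) / real b ^ n" for n
  proof -
    have "\<bar>digit_point b x j n - digit_point b x i n\<bar>
        = \<bar>\<Sum>k=1..n. (real (j k) - real (i k)) / real b ^ (n + 1 - k)\<bar>"
      by (simp add: digit_point_def diff_divide_distrib sum_subtractf)
    also have "\<dots> \<le> (\<Sum>k=1..n. \<bar>(real (j k) - real (i k)) / real b ^ (n + 1 - k)\<bar>)"
      by (rule sum_abs)
    also have "\<dots> = (\<Sum>k=1..n. f k / real b ^ n)"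
    proof (rule sum.cong)
      fix k assume k: "k \<in> {1..n}"
      then have "real b ^ n = real b ^ (k - 1) * real b ^ (n + 1 - k)"
        by (subst power_add[symmetric]) auto
      then show "\<bar>(real (j k) - real (i k)) / real b ^ (n + 1 - k)\<bar> = f k / real b ^ n"
        using b by (simp add: f_def field_simps)
    qed auto
    also have "\<dots> = (\<Sum>k\<in>{1..n} \<inter> {1..N}. f k / real b ^ n)"
      by (rule sum.mono_neutral_right) (use N in \<open>auto simp: f_def\<close>)
    also have "\<dots> \<le> (\<Sum>k=1..N. f k / real b ^ n)"
      by (rule sum_mono2) (auto simp: f_def)
    finally have "\<bar>digit_point b x j n - digit_point b x i n\<bar> \<le> (\<Sum>k=1..N. f k) / real b ^ n"
      by (simp add: sum_divide_distrib)
    from mult_left_mono[OF this L] show ?thesis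
      using lip[of "digit_point b x j n" "digit_point b x i n"] by (simp add: pe digit_diff_def)
  qed
  then show ?thesis by (rule that)
qed

text \<open>By the decay, each series extends holomorphically to the disc of radius
  \<open>b \<ge> 2\<close>, which contains the compact interval from 0 to 1 with both
  endpoints.\<close>

lemma finite_diff_series_jumps:
  fixes h :: "real \<Rightarrow> real ^ 'd"
  assumes lip: "\<And>x y. norm (h x - h y) \<le> L * \<bar>x - y\<bar>" and b: "b \<ge> 2"
    and t0: "t0 \<in> {0..1}"
  shows "finite {t \<in> {0..1}. dim (((\<lambda>p. diff_series h b p t0) ` tail_pairs b)\<^sup>\<bottom>)
      < dim (((\<lambda>p. diff_series h b p t) ` tail_pairs b)\<^sup>\<bottom>)}"
proof (rule finite_dim_orthogonal_comp_jumps[of "ball 0 (real b)"])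
  fix p and c :: 'd assume p: "p \<in> tail_pairs b"
  obtain K where K: "\<And>n. norm (digit_diff h b p n) \<le> K / real b ^ n"
    by (rule digit_diff_decay[OF lip _ p]) (use b in auto)
  obtain g where g: "g holomorphic_on ball 0 (real b)"
    "\<And>t. \<bar>t\<bar> < real b \<Longrightarrow> g (of_real t) = complex_of_real ((\<Sum>n. t ^ n *\<^sub>R digit_diff h b p n) $ c)"
    using powser_component_holomorphic_extension[OF K, where c = c] by metis
  then show "\<exists>g. g holomorphic_on ball 0 (real b) \<and>
      (\<forall>t\<in>{0..1}. g (of_real t) = complex_of_real (diff_series h b p t $ c))"
    using b g by (intro exI[of _ g]) (auto simp: diff_series_def)
qed (use b t0 in auto)

section \<open>Existence of a nonvanishing difference series\<close>

text \<open>The periods force the value \<open>h 0\<close> at all fractions \<open>k / b ^ n\<close>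
  with \<open>n > 0\<close>; these are dense and \<open>h\<close> is continuous.\<close>

lemma constant_of_small_periods:
  fixes h :: "real \<Rightarrow> 'a::metric_space"
  assumes cont: "continuous_on UNIV h" and b: "b \<ge> 2"
    and per: "\<And>x n. n > 0 \<Longrightarrow> h (x + 1 / real b ^ n) = h x"
  shows "h x = h 0"
proof -
  have nat_multiple: "h (x + real m / real b ^ n) = h x" if "n > 0" for x m n
  proof (induction m)
    case (Suc m)
    then show ?case
      using per[OF that, of "x + real m / real b ^ n"] by (simp add: add_divide_distrib add_ac)
  qed simp
  have int_multiple: "h (of_int k / real b ^ n) = h 0" if "n > 0" for k n
  proof (cases "k \<ge> 0")
    case True
    then show ?thesis using nat_multiple[OF that, of 0 "nat k"] by simp
  next
    case False
    then show ?thesis using nat_multiple[OF that, of "of_int k / real b ^ n" "nat (- k)"] by simp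
  qed
  \<comment> \<open>The largest multiple of \<open>1 / b ^ n\<close> that does not exceed
    \<open>x\<close>.\<close>
  define y where "y n = of_int \<lfloor>x * real b ^ n\<rfloor> / real b ^ n" for n
  have "y \<longlonglongrightarrow> x"
  proof (rule tendsto_sandwich)
    show "(\<lambda>n. x - (1 / real b) ^ n) \<longlonglongrightarrow> x"
      using b by (auto intro!: tendsto_eq_intros LIMSEQ_power_zero)
    show "\<forall>\<^sub>F n in sequentially. x - (1 / real b) ^ n \<le> y n"
    proof (intro always_eventually allI)
      fix n
      have "x * real b ^ n - 1 \<le> of_int \<lfloor>x * real b ^ n\<rfloor>" by linarith
      then have "(x * real b ^ n - 1) / real b ^ n \<le> y n"
        unfolding y_def by (rule divide_right_mono) simp
      then show "x - (1 / real b) ^ n \<le> y n"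
        using b by (simp add: diff_divide_distrib power_one_over)
    qed
    show "\<forall>\<^sub>F n in sequentially. y n \<le> x"
      using b by (intro always_eventually allI) (simp add: y_def divide_le_eq)
  qed auto
  then have "(\<lambda>n. h (y n)) \<longlonglongrightarrow> h x"
    using cont by (auto intro: continuous_on_tendsto_compose)
  moreover have "\<forall>\<^sub>F n in sequentially. h (y n) = h 0"
    using int_multiple by (auto simp: y_def eventually_sequentially intro!: exI[of _ 1])
  then have "(\<lambda>n. h (y n)) \<longlonglongrightarrow> h 0"
    by (rule tendsto_eventually)
  ultimately show ?thesis
    by (rule LIMSEQ_unique)
qed

text \<open>Such an \<open>f\<close> is affine with slope \<open>c\<close>, and equal values at 0
  and 1 force \<open>c = 0\<close>.\<close>

lemma Z_periodic_constant_derivative: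
  fixes f :: "real \<Rightarrow> 'a::real_normed_vector"
  assumes "Z_periodic f" and f': "\<And>x. (f has_vector_derivative c) (at x)"
  shows "f constant_on UNIV"
proof -
  have "((\<lambda>x. f x - x *\<^sub>R c) has_vector_derivative 0) (at x within UNIV)" for x
    by (auto intro!: derivative_eq_intros f')
  then obtain d where d: "\<And>x. f x - x *\<^sub>R c = d"
    using has_vector_derivative_zero_constant[of UNIV "\<lambda>x. f x - x *\<^sub>R c"] by auto
  have "f (0 + of_int 1) = f 0"
    using assms(1) unfolding Z_periodic_def by blast
  then have "c = 0"
    using d[of 0] d[of 1] by simp
  then show ?thesis
    using d by (auto simp: constant_on_def)
qed

text \<open>If all the series vanished, so would their coefficients. Two words that differ only in
  the first digit would then give \<open>h\<close> every period \<open>1 / b ^ n\<close> with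
  \<open>n > 0\<close>.\<close>

lemma exists_diff_series_nonzero:
  fixes h :: "real \<Rightarrow> real ^ 'd"
  assumes cont: "continuous_on UNIV h" and M: "\<And>x. norm (h x) \<le> M" and b: "b \<ge> 2"
    and nonconst: "\<And>c. h \<noteq> (\<lambda>_. c)"
  obtains p t where "p \<in> tail_pairs b" "0 < t" "t < 1" "diff_series h b p t \<noteq> 0"
proof (rule ccontr)
  assume "\<not> thesis"
  with that have zero: "diff_series h b p t = 0" if "p \<in> tail_pairs b" "0 < t" "t < 1" for p t
    using that by blast
  \<comment> \<open>The words 000... and 1000...; index 0 carries \<open>undefined\<close> because
    words are extensional functions on the indices from 1 on.\<close>
  define i where "i = (\<lambda>k::nat. if k = 0 then undefined else 0 :: nat)"
  define j where "j = (\<lambda>k::nat. if k = 0 then undefined else if k = 1 then 1 else 0 :: nat)"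
  have p: "(x, i, j) \<in> tail_pairs b" for x
    using b by (auto simp: tail_pairs_def digit_pairs_def digit_seqs_def PiE_iff extensional_def
        i_def j_def intro!: exI[of _ 1])
  have "h (x + 1 / real b ^ n) = h x" if n: "n > 0" for x n
  proof -
    \<comment> \<open>The starting point is scaled so that the \<open>n\<close>-th points of the two
      words are exactly \<open>x\<close> and \<open>x + 1 / b ^ n\<close>.\<close>
    have "digit_diff h b (x * real b ^ n, i, j) n = 0"
    proof (rule powser_scaleR_eq_0_imp_coeff_eq_0[of "digit_diff h b (x * real b ^ n, i, j)" "2 * M"])
      show "norm (digit_diff h b (x * real b ^ n, i, j) m) \<le> 2 * M" for m
        by (rule norm_digit_diff_le[OF M])
      show "(\<Sum>m. t ^ m *\<^sub>R digit_diff h b (x * real b ^ n, i, j) m) = 0" if "0 < t" "t < 1" for t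
        using zero[OF p that] by (simp add: diff_series_def)
      show "digit_diff h b (x * real b ^ n, i, j) 0 = 0"
        by (simp add: digit_diff_def digit_point_def)
    qed
    moreover have "(\<Sum>k=1..n. real (i k) / real b ^ (n + 1 - k)) = 0"
      by (rule sum.neutral) (auto simp: i_def)
    moreover have "(\<Sum>k=1..n. real (j k) / real b ^ (n + 1 - k)) = 1 / real b ^ n"
      using n by (subst sum.remove[of _ 1]) (auto simp: j_def intro!: sum.neutral)
    ultimately show ?thesis
      using b by (simp add: digit_diff_def digit_point_def)
  qed
  then have "h = (\<lambda>_. h 0)"
    using constant_of_small_periods[OF cont b] by blast
  then show False
    using nonconst by blast
qed

section \<open>The generic value of q' and the exceptional parameters\<close>

theorem theoremB:
  fixes b :: nat and \<phi> :: "real \<Rightarrow> real ^ 'd"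
  assumes "b \<ge> 2"
    and "Z_periodic \<phi>"
    and "Ck_function 3 \<phi>"
    and "\<not> \<phi> constant_on UNIV"
  shows "p_prime \<phi> b < CARD('d) \<and>
         finite {lam \<in> {1 / real b <..< 1}. p_prime \<phi> b < q_prime \<phi> lam b}"
proof -
  obtain D where D: "D 0 = \<phi>" "\<And>i x. i < 3 \<Longrightarrow> (D i has_vector_derivative D (Suc i) x) (at x)"
    using assms(3) unfolding Ck_function_def by blast
  define h where "h = D 1"
  have d1: "(\<phi> has_vector_derivative h x) (at x)" for x
    using D(2)[of 0] D(1) by (simp add: h_def)
  have d2: "(h has_vector_derivative D 2 x) (at x)" for x
    using D(2)[of 1 x] by (simp add: h_def numeral_2_eq_2)
  have d3: "(D 2 has_vector_derivative D 3 x) (at x)" for x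
    using D(2)[of 2 x] by (simp add: numeral_3_eq_3 numeral_2_eq_2)
  \<comment> \<open>Being continuous and periodic, \<open>D 2\<close> is bounded, which makes
    \<open>h\<close> Lipschitz.\<close>
  have cont: "continuous_on UNIV h" "continuous_on UNIV (D 2)"
    using d2 d3 by (meson continuous_at_imp_continuous_on has_vector_derivative_continuous)+
  have per: "Z_periodic h" "Z_periodic (D 2)"
    using Z_periodic_derivative assms(2) d1 d2 by blast+
  obtain M where M: "\<And>x. norm (h x) \<le> M"
    using Z_periodic_bounded[OF per(1) cont(1)] by blast
  obtain L where "\<And>x. norm (D 2 x) \<le> L"
    using Z_periodic_bounded[OF per(2) cont(2)] by blast
  then have lip: "norm (h x - h y) \<le> L * \<bar>x - y\<bar>" for x y
    using has_vector_derivative_bounded_imp_lipschitz[OF d2] by blast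
  define W where "W t = ((\<lambda>p. diff_series h b p t) ` tail_pairs b)\<^sup>\<bottom>" for t
  have finW: "finite {t \<in> {0..1}. dim (W t0) < dim (W t)}" if "t0 \<in> {0..1}" for t0
    unfolding W_def by (rule finite_diff_series_jumps[OF lip assms(1) that])
  let ?I = "{1 / real b <..< 1}"
  define \<gamma> where "\<gamma> lam = 1 / (real b * lam)" for lam
  have \<gamma>: "0 < \<gamma> lam" "\<gamma> lam < 1" if "lam \<in> ?I" for lam
  proof -
    have "1 < real b * lam"
      using that assms(1) by (simp add: divide_less_eq mult.commute)
    then show "0 < \<gamma> lam" "\<gamma> lam < 1" by (auto simp: \<gamma>_def)
  qed
  have q: "q_prime \<phi> lam b = dim (W (\<gamma> lam))" if "lam \<in> ?I" for lam
    unfolding W_def \<gamma>_def by (rule q_prime_eq[OF d1 M]) (use \<gamma>[OF that] in \<open>auto simp: \<gamma>_def\<close>)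
  have finI: "finite {lam \<in> ?I. dim (W t0) < dim (W (\<gamma> lam))}" if "t0 \<in> {0..1}" for t0
  proof (rule finite_surj[OF finW[OF that], of _ \<gamma>])
    \<comment> \<open>The substitution is an involution, so finiteness in \<open>t\<close> carries
      over to \<open>lam\<close>.\<close>
    have inv: "lam = \<gamma> (\<gamma> lam)" for lam
      using assms(1) by (simp add: \<gamma>_def)
    show "{lam \<in> ?I. dim (W t0) < dim (W (\<gamma> lam))} \<subseteq> \<gamma> ` {t \<in> {0..1}. dim (W t0) < dim (W t)}"
    proof
      fix lam assume "lam \<in> {lam \<in> ?I. dim (W t0) < dim (W (\<gamma> lam))}"
      then have lam: "lam \<in> ?I" "dim (W t0) < dim (W (\<gamma> lam))"
        by blast+
      then have "\<gamma> lam \<in> {t \<in> {0..1}. dim (W t0) < dim (W t)}"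
        using \<gamma>[OF lam(1)] by simp
      then show "lam \<in> \<gamma> ` {t \<in> {0..1}. dim (W t0) < dim (W t)}"
        by (rule rev_image_eqI) (rule inv)
    qed
  qed
  have "h \<noteq> (\<lambda>_. c)" for c
    using Z_periodic_constant_derivative[OF assms(2)] d1 assms(4) by metis
  then obtain p t0 where t0: "p \<in> tail_pairs b" "0 < t0" "t0 < 1" "diff_series h b p t0 \<noteq> 0"
    using exists_diff_series_nonzero[OF cont(1) M assms(1)] by metis
  have less_d: "dim (W t0) < CARD('d)"
  proof -
    have "W t0 \<noteq> UNIV"
    proof
      assume "W t0 = UNIV"
      then have "diff_series h b p t0 \<in> W t0" by simp
      then have "orthogonal (diff_series h b p t0) (diff_series h b p t0)"
        using t0(1) unfolding W_def orthogonal_comp_def by blast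
      then show False
        using t0(4) by (simp add: orthogonal_self)
    qed
    moreover have "subspace (W t0)"
      unfolding W_def by (rule subspace_orthogonal_comp)
    ultimately have "dim (W t0) \<noteq> DIM(real ^ 'd)"
      using dim_eq_full[of "W t0"] by (metis span_eq_iff)
    then show ?thesis
      using dim_subset_UNIV[of "W t0"] by simp
  qed
  \<comment> \<open>The point \<open>t0\<close> need not be a value of \<open>\<gamma>\<close> on
    \<open>?I\<close>. All but finitely many parameters still have a complement of dimension at most
    \<open>dim (W t0)\<close>, and the interval is infinite.\<close>
  have "infinite ?I"
    using assms(1) by (simp add: infinite_Ioo)
  moreover have "finite {lam \<in> ?I. dim (W t0) < dim (W (\<gamma> lam))}"
    using finI[of t0] t0 by simp
  ultimately have "\<not> ?I \<subseteq> {lam \<in> ?I. dim (W t0) < dim (W (\<gamma> lam))}"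
    using finite_subset by blast
  then obtain lam where lam: "lam \<in> ?I" "dim (W (\<gamma> lam)) \<le> dim (W t0)"
    using not_le_imp_less by blast
  have "p_prime \<phi> b \<le> q_prime \<phi> lam b"
    unfolding p_prime_def by (rule Min_le[OF p_prime_set(1)]) (rule imageI[OF lam(1)])
  then have less: "p_prime \<phi> b < CARD('d)"
    using q lam less_d by simp
  have "p_prime \<phi> b \<in> (\<lambda>lam. q_prime \<phi> lam b) ` ?I"
    unfolding p_prime_def by (rule Min_in[OF p_prime_set]) (rule assms(1))
  then obtain lam1 where lam1: "lam1 \<in> ?I" "p_prime \<phi> b = dim (W (\<gamma> lam1))"
    using q by auto
  \<comment> \<open>The minimum is attained at \<open>lam1\<close>, so the exceptional parameters
    are the jumps relative to the base point \<open>\<gamma> lam1\<close>.\<close>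
  have "{lam \<in> ?I. p_prime \<phi> b < q_prime \<phi> lam b} = {lam \<in> ?I. dim (W (\<gamma> lam1)) < dim (W (\<gamma> lam))}"
    using q lam1 by auto
  with less show ?thesis
    using finI[of "\<gamma> lam1"] \<gamma>[OF lam1(1)] by simp
qed

end
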